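(* Let $(\Omega,\mathcal{F},\mathbb{P})$ be a probability space, let $\mathcal{A}\subset L^\infty$ be an acceptance set and let $S=(S_0,S_1)$ be an eligible asset. Assume that $\rho_{\mathcal{A}}$ is comonotonic. Then the following statements are equivalent: (a) $\rho_{\mathcal{A},S}$ is comonotonic. (b) $\mathcal{A}\pm\big(1+\tfrac{\rho_{\mathcal{A},S}(1)}{S_0}S_1\big)\subset\mathcal{A}$, i.e. for every $X\in\mathcal{A}$ both $X+\big(1+\tfrac{\rho_{\mathcal{A},S}(1)}{S_0}S_1\big)$ and $X-\big(1+\tfrac{\rho_{\mathcal{A},S}(1)}{S_0}S_1\big)$ belong to $\mathcal{A}$. In particular, $\rho_{\mathcal{A},S}$ is comonotonic only if $S_1+\tfrac{S_0}{\rho_{\mathcal{A},S}(1)}\in\mathcal{A}\cap(-\mathcal{A})$.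
   Context: $L^\infty=L^\infty(\Omega,\mathcal{F},\mathbb{P})$ is the space of (a.s.-equivalence classes of) essentially bounded real random variables, with the essential supremum norm $\|\cdot\|$ and the almost sure order; $L^\infty_+=\{X\in L^\infty : X\ge 0\}$. Constants are identified with constant random variables. An acceptance set is a nonempty proper subset $\mathcal{A}\subset L^\infty$ that is norm-closed and increasing, i.e. $\mathcal{A}+L^\infty_+\subset\mathcal{A}$. An eligible asset is a pair $S=(S_0,S_1)\in(0,\infty)\times L^\infty_+$ with $S_1\ge\varepsilon$ a.s. for some constant $\varepsilon>0$. The associated risk measure is $\rho_{\mathcal{A},S}:L^\infty\to\mathbb{R}$, $\rho_{\mathcal{A},S}(X)=\inf\{m\in\mathbb{R} : X+\tfrac{m}{S_0}S_1\in\mathcal{A}\}$ (finitely valued under these assumptions), and $\rho_{\mathcal{A}}(X)=\inf\{m\in\mathbb{R} : X+m\in\mathcal{A}\}$ (the case $S=(1,1)$). Two random variables $X,Y\in L^\infty$ are comonotone if there is a $\mathbb{P}\otimes\mathbb{P}$-null set $N$ such that $(X(\omega)-X(\omega'))(Y(\omega)-Y(\omega'))\ge0$ for all $(\omega,\omega')\in(\Omega\times\Omega)\setminus N$. A functional $\rho:L^\infty\to\mathbb{R}$ is comonotonic if $\rho(X+Y)=\rho(X)+\rho(Y)$ for all comonotone $X,Y\in L^\infty$. *)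

theory Defs
  imports "HOL-Probability.Probability"
begin

text \<open>
  Elements of the space of essentially bounded random variables are represented by measurable
  functions; equality in that space is almost sure equality of representatives. A subset of the
  space is represented by the set of all representatives of its members. For increasing sets
  invariance under almost sure equality is automatic, see \<open>acceptance_set_AE_cong\<close> below.
\<close>

definition Linf :: "'a measure \<Rightarrow> ('a \<Rightarrow> real) set" where
  "Linf M = {X \<in> borel_measurable M. \<exists>C::real. AE \<omega> in M. \<bar>X \<omega>\<bar> \<le> C}"

definition Linf_norm :: "'a measure \<Rightarrow> ('a \<Rightarrow> real) \<Rightarrow> real" where
  "Linf_norm M X = real_of_ereal (esssup M (\<lambda>\<omega>. ereal \<bar>X \<omega>\<bar>))"

definition Linf_plus :: "'a measure \<Rightarrow> ('a \<Rightarrow> real) set" where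
  "Linf_plus M = {X \<in> Linf M. AE \<omega> in M. 0 \<le> X \<omega>}"

definition Linf_closed :: "'a measure \<Rightarrow> ('a \<Rightarrow> real) set \<Rightarrow> bool" where
  "Linf_closed M A \<longleftrightarrow>
     (\<forall>X\<in>Linf M. (\<forall>e>0. \<exists>Y\<in>A. Linf_norm M (\<lambda>\<omega>. Y \<omega> - X \<omega>) < e) \<longrightarrow> X \<in> A)"

definition acceptance_set :: "'a measure \<Rightarrow> ('a \<Rightarrow> real) set \<Rightarrow> bool" where
  "acceptance_set M A \<longleftrightarrow>
     A \<noteq> {} \<and> A \<subset> Linf M \<and> Linf_closed M A \<and>
     (\<forall>X\<in>A. \<forall>Z\<in>Linf_plus M. (\<lambda>\<omega>. X \<omega> + Z \<omega>) \<in> A)"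

definition eligible_asset :: "'a measure \<Rightarrow> real \<times> ('a \<Rightarrow> real) \<Rightarrow> bool" where
  "eligible_asset M S \<longleftrightarrow>
     fst S > 0 \<and> snd S \<in> Linf_plus M \<and> (\<exists>\<epsilon>>0. AE \<omega> in M. snd S \<omega> \<ge> \<epsilon>)"

definition risk_measure ::
    "('a \<Rightarrow> real) set \<Rightarrow> real \<times> ('a \<Rightarrow> real) \<Rightarrow> ('a \<Rightarrow> real) \<Rightarrow> real" where
  "risk_measure A S X = Inf {m. (\<lambda>\<omega>. X \<omega> + m / fst S * snd S \<omega>) \<in> A}"

definition cash_risk_measure :: "('a \<Rightarrow> real) set \<Rightarrow> ('a \<Rightarrow> real) \<Rightarrow> real" where
  "cash_risk_measure A X = Inf {m. (\<lambda>\<omega>. X \<omega> + m) \<in> A}"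

definition comonotone :: "'a measure \<Rightarrow> ('a \<Rightarrow> real) \<Rightarrow> ('a \<Rightarrow> real) \<Rightarrow> bool" where
  "comonotone M X Y \<longleftrightarrow>
     (\<exists>N\<in>null_sets (M \<Otimes>\<^sub>M M). \<forall>(\<omega>, \<omega>')\<in>space M \<times> space M - N.
        (X \<omega> - X \<omega>') * (Y \<omega> - Y \<omega>') \<ge> 0)"

definition comonotonic :: "'a measure \<Rightarrow> (('a \<Rightarrow> real) \<Rightarrow> real) \<Rightarrow> bool" where
  "comonotonic M \<rho> \<longleftrightarrow>
     (\<forall>X\<in>Linf M. \<forall>Y\<in>Linf M. comonotone M X Y \<longrightarrow> \<rho> (\<lambda>\<omega>. X \<omega> + Y \<omega>) = \<rho> X + \<rho> Y)"

lemma acceptance_set_AE_cong: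
  assumes A: "acceptance_set M A" and X: "X \<in> A"
    and Y: "Y \<in> borel_measurable M" and eq: "AE \<omega> in M. X \<omega> = Y \<omega>"
  shows "Y \<in> A"
proof -
  have [measurable]: "X \<in> borel_measurable M" "Y \<in> borel_measurable M"
    using A X Y by (auto simp: acceptance_set_def Linf_def)
  have meas: "(\<lambda>\<omega>. Y \<omega> - X \<omega>) \<in> borel_measurable M"
    by measurable
  have "AE \<omega> in M. \<bar>Y \<omega> - X \<omega>\<bar> \<le> 0" and pos: "AE \<omega> in M. 0 \<le> Y \<omega> - X \<omega>"
    using eq by (eventually_elim, simp)+
  with meas have "(\<lambda>\<omega>. Y \<omega> - X \<omega>) \<in> Linf M"
    unfolding Linf_def mem_Collect_eq by (intro conjI exI)
  with pos have "(\<lambda>\<omega>. Y \<omega> - X \<omega>) \<in> Linf_plus M"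
    by (simp only: Linf_plus_def mem_Collect_eq)
  then have "(\<lambda>\<omega>. X \<omega> + (Y \<omega> - X \<omega>)) \<in> A"
    using A X unfolding acceptance_set_def by (elim conjE) (drule (1) bspec)+
  then show ?thesis by simp
qed

end

theory Submission
  imports Defs
begin

text \<open>
  Write \<open>U = S1 / S0\<close> and \<open>\<rho>\<close> for the risk measure of \<open>(S0, S1)\<close>. Closedness and monotonicity of \<open>A\<close> turn membership of \<open>X + m U\<close> in \<open>A\<close>
  into the inequality \<open>\<rho> X \<le> m\<close>; the cash risk measure is the case \<open>U = 1\<close>. Comonotonicity
  makes the cash risk measure positively homogeneous, so \<open>A\<close> is a cone and \<open>\<rho> 1 = - 1 / p\<close>,
  where \<open>p > 0\<close> is the cash risk of \<open>- U\<close>. Put \<open>V = 1 + \<rho> 1 U\<close>. If \<open>A \<plusminus> V\<close> lies in \<open>A\<close>, then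
  \<open>A\<close> is invariant under all multiples of \<open>V\<close>, and \<open>X + m U = (X + m p) - m p V\<close> shows that
  \<open>\<rho>\<close> is the cash risk measure divided by \<open>p\<close>. Conversely, constants are comonotone with
  everything, so \<open>\<rho> (X \<plusminus> V) = \<rho> X\<close> for comonotonic \<open>\<rho>\<close>.
\<close>

section \<open>Essentially bounded functions\<close>

lemma Linf_measurable: "X \<in> Linf M \<Longrightarrow> X \<in> borel_measurable M"
  by (simp add: Linf_def)

lemma Linf_const [simp]: "(\<lambda>_. c) \<in> Linf M"
  unfolding Linf_def by (auto intro!: exI[of _ "\<bar>c\<bar>"])

text \<open>A strictly positive bound can serve as a divisor, as in the choice of \<open>d\<close>
  in \<open>risk_le_iff\<close>.\<close>

lemma Linf_bound:
  assumes "X \<in> Linf M"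
  obtains C where "C > 0" "AE \<omega> in M. \<bar>X \<omega>\<bar> \<le> C"
proof -
  obtain C where "AE \<omega> in M. \<bar>X \<omega>\<bar> \<le> C"
    using assms by (auto simp: Linf_def)
  then have "AE \<omega> in M. \<bar>X \<omega>\<bar> \<le> max C 1"
    by eventually_elim auto
  then show ?thesis
    by (rule that[rotated]) simp
qed

lemma Linf_add [intro]:
  assumes "X \<in> Linf M" "Y \<in> Linf M"
  shows "(\<lambda>\<omega>. X \<omega> + Y \<omega>) \<in> Linf M"
proof -
  obtain C D where "AE \<omega> in M. \<bar>X \<omega>\<bar> \<le> C" "AE \<omega> in M. \<bar>Y \<omega>\<bar> \<le> D"
    using assms by (auto simp: Linf_def)
  then have "AE \<omega> in M. \<bar>X \<omega> + Y \<omega>\<bar> \<le> C + D"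
    by eventually_elim auto
  then show ?thesis
    using assms unfolding Linf_def by auto
qed

lemma Linf_cmult [intro]:
  assumes "X \<in> Linf M"
  shows "(\<lambda>\<omega>. c * X \<omega>) \<in> Linf M"
proof -
  obtain C where "AE \<omega> in M. \<bar>X \<omega>\<bar> \<le> C"
    using assms by (auto simp: Linf_def)
  then have "AE \<omega> in M. \<bar>c * X \<omega>\<bar> \<le> \<bar>c\<bar> * C"
    by eventually_elim (simp add: abs_mult mult_left_mono)
  then show ?thesis
    using assms unfolding Linf_def by auto
qed

lemma Linf_diff [intro]:
  assumes "X \<in> Linf M" "Y \<in> Linf M"
  shows "(\<lambda>\<omega>. X \<omega> - Y \<omega>) \<in> Linf M"
  using Linf_add[OF assms(1) Linf_cmult[OF assms(2), of "-1"]] by simp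

lemma Linf_norm_le:
  assumes "Y \<in> borel_measurable M" "AE \<omega> in M. \<bar>Y \<omega>\<bar> \<le> c" "c \<ge> 0"
  shows "Linf_norm M Y \<le> c"
proof -
  have "esssup M (\<lambda>\<omega>. ereal \<bar>Y \<omega>\<bar>) \<le> ereal c"
    using assms by (intro esssup_I) auto
  then show ?thesis
    unfolding Linf_norm_def using assms(3)
    by (cases "esssup M (\<lambda>\<omega>. ereal \<bar>Y \<omega>\<bar>)") auto
qed

section \<open>Comonotone pairs and comonotonic functionals\<close>

lemma comonotone_const [simp]: "comonotone M X (\<lambda>_. c)"
  unfolding comonotone_def by (intro bexI[of _ "{}"]) auto

text \<open>The product of the increments is \<open>s * t\<close> times a square. This is the source
  of positive homogeneity of the cash risk measure.\<close>

lemma comonotone_cmult: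
  assumes "s \<ge> 0" "t \<ge> 0"
  shows "comonotone M (\<lambda>\<omega>. s * X \<omega>) (\<lambda>\<omega>. t * X \<omega>)"
proof -
  have "(s * X \<omega> - s * X \<omega>') * (t * X \<omega> - t * X \<omega>') = (s * t) * (X \<omega> - X \<omega>')\<^sup>2" for \<omega> \<omega>'
    by (simp add: algebra_simps power2_eq_square)
  with assms show ?thesis
    unfolding comonotone_def by (intro bexI[of _ "{}"]) auto
qed

lemma comonotonic_add_const:
  assumes "comonotonic M \<rho>" "X \<in> Linf M"
  shows "\<rho> (\<lambda>\<omega>. X \<omega> + c) = \<rho> X + \<rho> (\<lambda>_. c)"
  using assms(1)[unfolded comonotonic_def, rule_format, OF assms(2) Linf_const comonotone_const] .

lemma comonotonic_zero:
  assumes "comonotonic M \<rho>"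
  shows "\<rho> (\<lambda>_. 0) = 0"
  using comonotonic_add_const[OF assms Linf_const, of 0 0] by simp

lemma acceptance_set_mono:
  assumes A: "acceptance_set M A" and X: "X \<in> A" and Y: "Y \<in> Linf M"
    and le: "AE \<omega> in M. X \<omega> \<le> Y \<omega>"
  shows "Y \<in> A"
proof -
  have "X \<in> Linf M"
    using A X by (auto simp: acceptance_set_def)
  then have "(\<lambda>\<omega>. Y \<omega> - X \<omega>) \<in> Linf_plus M"
    using Y le by (auto simp: Linf_plus_def)
  then have "(\<lambda>\<omega>. X \<omega> + (Y \<omega> - X \<omega>)) \<in> A"
    using A X unfolding acceptance_set_def by (elim conjE) (drule (1) bspec)+
  then show ?thesis by simp
qed

text \<open>Together with \<open>cash_risk_measure_eq\<close> this makes every result about a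
  general asset available for cash.\<close>

lemma eligible_asset_cash: "eligible_asset M (1, \<lambda>_. 1)"
  unfolding eligible_asset_def Linf_plus_def by (auto intro: exI[of _ 1])

lemma cash_risk_measure_eq: "cash_risk_measure A = risk_measure A (1, \<lambda>_. 1)"
  by (auto simp: cash_risk_measure_def risk_measure_def)

section \<open>Risk measures of an arbitrary eligible asset\<close>

locale risk_setting =
  fixes M :: "'a measure" and A :: "('a \<Rightarrow> real) set" and S0 :: real and S1 :: "'a \<Rightarrow> real"
  assumes acceptance: "acceptance_set M A"
    and eligible: "eligible_asset M (S0, S1)"
begin

abbreviation \<rho> :: "('a \<Rightarrow> real) \<Rightarrow> real" where
  "\<rho> \<equiv> risk_measure A (S0, S1)"

lemma A_Linf: "X \<in> A \<Longrightarrow> X \<in> Linf M"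
  using acceptance by (auto simp: acceptance_set_def)

lemma S0_pos: "S0 > 0"
  using eligible by (simp add: eligible_asset_def)

lemma S1_Linf: "S1 \<in> Linf M"
  using eligible by (simp add: eligible_asset_def Linf_plus_def)

lemma add_asset_Linf: "X \<in> Linf M \<Longrightarrow> (\<lambda>\<omega>. X \<omega> + c * S1 \<omega>) \<in> Linf M"
  using S1_Linf by (intro Linf_add Linf_cmult)

lemma payoff_bound:
  obtains \<delta> where "\<delta> > 0" "AE \<omega> in M. S1 \<omega> / S0 \<ge> \<delta>"
proof -
  obtain \<epsilon> where \<epsilon>: "\<epsilon> > 0" "AE \<omega> in M. S1 \<omega> \<ge> \<epsilon>"
    using eligible by (auto simp: eligible_asset_def)
  from \<epsilon>(2) have "AE \<omega> in M. S1 \<omega> / S0 \<ge> \<epsilon> / S0"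
    by eventually_elim (use S0_pos in \<open>simp add: divide_right_mono\<close>)
  with \<epsilon>(1) S0_pos show ?thesis
    by (intro that[of "\<epsilon> / S0"]) auto
qed

text \<open>The payoff per unit of capital is at least some \<delta> > 0, so capital
  \<open>C / \<delta>\<close> covers a gap of size at most \<open>C\<close>. Applied to an accepted
  and to a rejected position, this makes the risk finite.\<close>

lemma dominating_multiple:
  assumes "X \<in> Linf M" "Y \<in> Linf M"
  obtains m where "\<And>k. k \<ge> m \<Longrightarrow> AE \<omega> in M. Y \<omega> \<le> X \<omega> + k / S0 * S1 \<omega>"
proof -
  obtain C where C: "C > 0" "AE \<omega> in M. \<bar>Y \<omega> - X \<omega>\<bar> \<le> C"
    using Linf_bound[OF Linf_diff[OF assms(2,1)]] by blast
  obtain \<delta> where \<delta>: "\<delta> > 0" "AE \<omega> in M. S1 \<omega> / S0 \<ge> \<delta>"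
    by (rule payoff_bound)
  have "AE \<omega> in M. Y \<omega> \<le> X \<omega> + k / S0 * S1 \<omega>" if k: "k \<ge> C / \<delta>" for k
    using C(2) \<delta>(2)
  proof eventually_elim
    fix \<omega> assume 1: "\<bar>Y \<omega> - X \<omega>\<bar> \<le> C" and 2: "\<delta> \<le> S1 \<omega> / S0"
    have "C = C / \<delta> * \<delta>" using \<delta> by simp
    also have "\<dots> \<le> k * (S1 \<omega> / S0)"
      using C(1) \<delta>(1) k 2 by (intro mult_mono) (auto intro: order_trans[of _ "C / \<delta>"])
    finally show "Y \<omega> \<le> X \<omega> + k / S0 * S1 \<omega>" using 1 by simp
  qed
  then show ?thesis by (rule that)
qed

lemma add_asset_mono:
  assumes X: "X \<in> Linf M" and mem: "(\<lambda>\<omega>. X \<omega> + m / S0 * S1 \<omega>) \<in> A" and le: "m \<le> k"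
  shows "(\<lambda>\<omega>. X \<omega> + k / S0 * S1 \<omega>) \<in> A"
proof -
  obtain \<delta> where \<delta>: "\<delta> > 0" "AE \<omega> in M. S1 \<omega> / S0 \<ge> \<delta>"
    by (rule payoff_bound)
  from \<delta>(2) have "AE \<omega> in M. X \<omega> + m / S0 * S1 \<omega> \<le> X \<omega> + k / S0 * S1 \<omega>"
  proof eventually_elim
    fix \<omega> assume "\<delta> \<le> S1 \<omega> / S0"
    then have "m * (S1 \<omega> / S0) \<le> k * (S1 \<omega> / S0)"
      using \<delta>(1) le by (intro mult_right_mono) auto
    then show "X \<omega> + m / S0 * S1 \<omega> \<le> X \<omega> + k / S0 * S1 \<omega>" by simp
  qed
  then show ?thesis
    by (rule acceptance_set_mono[OF acceptance mem add_asset_Linf[OF X]])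
qed

lemma risk_set_nonempty:
  assumes "X \<in> Linf M"
  shows "{m. (\<lambda>\<omega>. X \<omega> + m / S0 * S1 \<omega>) \<in> A} \<noteq> {}"
proof -
  obtain Y where Y: "Y \<in> A" using acceptance by (auto simp: acceptance_set_def)
  obtain m where "AE \<omega> in M. Y \<omega> \<le> X \<omega> + m / S0 * S1 \<omega>"
    using dominating_multiple[OF assms A_Linf[OF Y]] by (metis order_refl)
  then have "(\<lambda>\<omega>. X \<omega> + m / S0 * S1 \<omega>) \<in> A"
    by (rule acceptance_set_mono[OF acceptance Y add_asset_Linf[OF assms]])
  then show ?thesis by blast
qed

lemma risk_set_bdd_below:
  assumes X: "X \<in> Linf M"
  shows "bdd_below {m. (\<lambda>\<omega>. X \<omega> + m / S0 * S1 \<omega>) \<in> A}"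
proof -
  obtain Z where Z: "Z \<in> Linf M" "Z \<notin> A" using acceptance by (auto simp: acceptance_set_def)
  obtain m where m: "\<And>k. k \<ge> m \<Longrightarrow> AE \<omega> in M. X \<omega> \<le> Z \<omega> + k / S0 * S1 \<omega>"
    using dominating_multiple[OF Z(1) X] by blast
  \<comment> \<open>Were \<open>k\<close> below \<open>- m\<close>, the rejected \<open>Z\<close>
    would dominate the accepted position \<open>X + k U\<close>.\<close>
  have "- m \<le> k" if k: "(\<lambda>\<omega>. X \<omega> + k / S0 * S1 \<omega>) \<in> A" for k
  proof (rule ccontr)
    assume "\<not> - m \<le> k"
    then have "AE \<omega> in M. X \<omega> \<le> Z \<omega> + (- k) / S0 * S1 \<omega>" by (intro m) simp
    then have "AE \<omega> in M. X \<omega> + k / S0 * S1 \<omega> \<le> Z \<omega>" by eventually_elim simp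
    then show False
      using acceptance_set_mono[OF acceptance k Z(1)] Z(2) by blast
  qed
  then show ?thesis by (intro bdd_belowI[of _ "- m"]) auto
qed

text \<open>The infimum is attained: monotonicity accepts every level above \<open>m\<close>, and
  norm-closedness passes to \<open>m\<close> itself. From here on, membership in \<open>A\<close> is
  handled as an inequality between reals.\<close>

lemma risk_le_iff:
  assumes X: "X \<in> Linf M"
  shows "\<rho> X \<le> m \<longleftrightarrow> (\<lambda>\<omega>. X \<omega> + m / S0 * S1 \<omega>) \<in> A"
proof
  assume "(\<lambda>\<omega>. X \<omega> + m / S0 * S1 \<omega>) \<in> A"
  then show "\<rho> X \<le> m"
    unfolding risk_measure_def using risk_set_bdd_below[OF X] by (auto intro: cInf_lower)
next
  assume le: "\<rho> X \<le> m"
  have above: "(\<lambda>\<omega>. X \<omega> + k / S0 * S1 \<omega>) \<in> A" if "k > m" for k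
  proof -
    have "Inf {m. (\<lambda>\<omega>. X \<omega> + m / S0 * S1 \<omega>) \<in> A} < k"
      using le that by (simp add: risk_measure_def)
    then obtain l where "(\<lambda>\<omega>. X \<omega> + l / S0 * S1 \<omega>) \<in> A" "l < k"
      using cInf_lessD[OF risk_set_nonempty[OF X]] by blast
    then show ?thesis using add_asset_mono[OF X, of l k] by simp
  qed
  obtain C where C: "C > 0" "AE \<omega> in M. \<bar>S1 \<omega>\<bar> \<le> C"
    using Linf_bound[OF S1_Linf] .
  have "\<exists>Y\<in>A. Linf_norm M (\<lambda>\<omega>. Y \<omega> - (X \<omega> + m / S0 * S1 \<omega>)) < e" if e: "e > 0" for e
  proof -
    \<comment> \<open>Chosen so that \<open>d / S0 * C = e / 2\<close>: raising the level from
      \<open>m\<close> to \<open>m + d\<close> moves the position by at most half the tolerance,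
      which leaves the strict inequality.\<close>
    define d where "d = e * S0 / (2 * C)"
    have d: "d > 0" using e S0_pos C by (simp add: d_def)
    have "AE \<omega> in M. \<bar>X \<omega> + (m + d) / S0 * S1 \<omega> - (X \<omega> + m / S0 * S1 \<omega>)\<bar> \<le> e / 2"
      using C(2)
    proof eventually_elim
      fix \<omega> assume "\<bar>S1 \<omega>\<bar> \<le> C"
      then have "d / S0 * \<bar>S1 \<omega>\<bar> \<le> d / S0 * C"
        using d S0_pos by (intro mult_left_mono) auto
      also have "\<dots> = e / 2" using S0_pos C by (simp add: d_def)
      finally show "\<bar>X \<omega> + (m + d) / S0 * S1 \<omega> - (X \<omega> + m / S0 * S1 \<omega>)\<bar> \<le> e / 2"
        using d S0_pos by (simp add: add_divide_distrib ring_distribs abs_mult)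
    qed
    then have "Linf_norm M (\<lambda>\<omega>. X \<omega> + (m + d) / S0 * S1 \<omega> - (X \<omega> + m / S0 * S1 \<omega>)) \<le> e / 2"
      using e by (intro Linf_norm_le Linf_measurable[OF Linf_diff] add_asset_Linf X) simp_all
    then show ?thesis
      using e by (intro bexI[OF _ above[of "m + d"]]) (use d in auto)
  qed
  then have approx: "\<forall>e>0. \<exists>Y\<in>A. Linf_norm M (\<lambda>\<omega>. Y \<omega> - (X \<omega> + m / S0 * S1 \<omega>)) < e"
    by blast
  have "Linf_closed M A" using acceptance by (simp add: acceptance_set_def)
  from this[unfolded Linf_closed_def, THEN bspec, OF add_asset_Linf[OF X], THEN mp, OF approx]
  show "(\<lambda>\<omega>. X \<omega> + m / S0 * S1 \<omega>) \<in> A" .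
qed

lemma mem_iff_risk_le: "X \<in> Linf M \<Longrightarrow> X \<in> A \<longleftrightarrow> \<rho> X \<le> 0"
  using risk_le_iff[of X 0] by simp

lemma risk_add_asset:
  assumes X: "X \<in> Linf M"
  shows "\<rho> (\<lambda>\<omega>. X \<omega> + k / S0 * S1 \<omega>) = \<rho> X - k"
proof -
  have "\<rho> (\<lambda>\<omega>. X \<omega> + k / S0 * S1 \<omega>) \<le> m \<longleftrightarrow> \<rho> X \<le> k + m" for m
  proof -
    have "(\<lambda>\<omega>. X \<omega> + k / S0 * S1 \<omega> + m / S0 * S1 \<omega>) = (\<lambda>\<omega>. X \<omega> + (k + m) / S0 * S1 \<omega>)"
      by (simp add: add_divide_distrib ring_distribs add.assoc)
    then show ?thesis by (simp only: risk_le_iff X add_asset_Linf)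
  qed
  \<comment> \<open>Both sides have the same upper bounds; inserting each value as the bound for the
    other gives the two inequalities.\<close>
  from this[of "\<rho> X - k"] this[of "\<rho> (\<lambda>\<omega>. X \<omega> + k / S0 * S1 \<omega>)"]
  show ?thesis by simp
qed

lemma risk_antimono:
  assumes "X \<in> Linf M" "Y \<in> Linf M" "AE \<omega> in M. X \<omega> \<le> Y \<omega>"
  shows "\<rho> Y \<le> \<rho> X"
proof -
  have mem: "(\<lambda>\<omega>. X \<omega> + \<rho> X / S0 * S1 \<omega>) \<in> A"
    using risk_le_iff[OF assms(1), of "\<rho> X"] by simp
  have "AE \<omega> in M. X \<omega> + \<rho> X / S0 * S1 \<omega> \<le> Y \<omega> + \<rho> X / S0 * S1 \<omega>"
    using assms(3) by eventually_elim simp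
  then have "(\<lambda>\<omega>. Y \<omega> + \<rho> X / S0 * S1 \<omega>) \<in> A"
    by (rule acceptance_set_mono[OF acceptance mem add_asset_Linf[OF assms(2)]])
  then show ?thesis by (simp add: risk_le_iff assms(2))
qed

lemma comonotonic_imp_invariant:
  assumes co: "comonotonic M \<rho>"
  shows "\<forall>X\<in>A. (\<lambda>\<omega>. X \<omega> + (1 + \<rho> (\<lambda>_. 1) / S0 * S1 \<omega>)) \<in> A \<and>
      (\<lambda>\<omega>. X \<omega> - (1 + \<rho> (\<lambda>_. 1) / S0 * S1 \<omega>)) \<in> A"
proof (intro ballI conjI)
  fix X assume X: "X \<in> A"
  let ?r = "\<rho> (\<lambda>_. 1)"
  have XL: "X \<in> Linf M" using X by (rule A_Linf)
  have neg: "\<rho> (\<lambda>_. -1) = - ?r"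
    using comonotonic_add_const[OF co, of "\<lambda>_. 1" "-1"] comonotonic_zero[OF co] by simp
  \<comment> \<open>One argument for both signs: the constant \<open>c\<close> changes the risk by
    \<open>\<rho> (\<lambda>_. c) = k\<close>, and \<open>k\<close> units of capital in the asset
    cancel exactly this change.\<close>
  have shift: "(\<lambda>\<omega>. X \<omega> + c + k / S0 * S1 \<omega>) \<in> A" if "\<rho> (\<lambda>_. c) = k" for c k
  proof -
    have L: "(\<lambda>\<omega>. X \<omega> + c) \<in> Linf M" using XL by (intro Linf_add) auto
    have "\<rho> (\<lambda>\<omega>. X \<omega> + c + k / S0 * S1 \<omega>) = \<rho> X"
      using risk_add_asset[OF L] comonotonic_add_const[OF co XL] that by simp
    then show ?thesis
      using X mem_iff_risk_le[OF XL] mem_iff_risk_le[OF add_asset_Linf[OF L, of "k / S0"]] by simp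
  qed
  show "(\<lambda>\<omega>. X \<omega> + (1 + ?r / S0 * S1 \<omega>)) \<in> A"
    using shift[OF refl, of 1] by (simp add: add.assoc)
  show "(\<lambda>\<omega>. X \<omega> - (1 + ?r / S0 * S1 \<omega>)) \<in> A"
    using shift[OF neg] by (simp add: diff_diff_eq)
qed

end

section \<open>Cauchy's functional equation on the half line\<close>

lemma additive_bounded_imp_homogeneous:
  fixes f :: "real \<Rightarrow> real"
  assumes add: "\<And>s t. s \<ge> 0 \<Longrightarrow> t \<ge> 0 \<Longrightarrow> f (s + t) = f s + f t"
    and bound: "\<And>t. t \<ge> 0 \<Longrightarrow> \<bar>f t\<bar> \<le> K * t"
    and t: "t \<ge> 0"
  shows "f t = t * f 1"
proof -
  \<comment> \<open>Subtracting the expected linear function leaves an additive \<open>g\<close>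
    with \<open>g 1 = 0\<close>. It remains to show that \<open>g\<close> is bounded, since a
    bounded additive function on the half line vanishes.\<close>
  define g where "g t = f t - t * f 1" for t
  have g_add: "g (s + t) = g s + g t" if "s \<ge> 0" "t \<ge> 0" for s t
    using add[OF that] by (simp add: g_def algebra_simps)
  have g0: "g 0 = 0" using g_add[of 0 0] by simp
  have g_mult: "g (real n * t) = real n * g t" if "t \<ge> 0" for n t
  proof (induction n)
    case (Suc n)
    then show ?case using g_add[of t "real n * t"] that by (simp add: algebra_simps)
  qed (simp add: g0)
  have K: "K \<ge> 0" using bound[of 1] by simp
  have g_bound: "\<bar>g t\<bar> \<le> 2 * K" if t: "t \<ge> 0" for t
  proof -
    have fl: "real (nat \<lfloor>t\<rfloor>) = of_int \<lfloor>t\<rfloor>" using t by simp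
    \<comment> \<open>As \<open>g 1 = 0\<close>, the integer part contributes nothing, and only
      values on the unit interval need a bound.\<close>
    have "g t = g (frac t + real (nat \<lfloor>t\<rfloor>) * 1)" using fl by (simp add: frac_def)
    also have "\<dots> = g (frac t) + real (nat \<lfloor>t\<rfloor>) * g 1"
      using g_add[of "frac t" "real (nat \<lfloor>t\<rfloor>) * 1"] g_mult[of 1 "nat \<lfloor>t\<rfloor>"] frac_ge_0[of t]
      by simp
    also have "\<dots> = f (frac t) - frac t * f 1" by (simp add: g_def)
    also have "\<bar>\<dots>\<bar> \<le> \<bar>f (frac t)\<bar> + frac t * \<bar>f 1\<bar>"
      using abs_triangle_ineq4[of "f (frac t)" "frac t * f 1"] frac_ge_0[of t]
      by (simp add: abs_mult)
    also have "\<dots> \<le> K * 1 + 1 * K"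
    proof (intro add_mono mult_mono)
      show "\<bar>f (frac t)\<bar> \<le> K * 1"
        using bound[of "frac t"] frac_ge_0[of t] frac_lt_1[of t] K
        by (meson less_imp_le mult_left_mono order_trans)
      show "\<bar>f 1\<bar> \<le> K" using bound[of 1] by simp
    qed (use frac_lt_1[of t] in \<open>auto intro: less_imp_le\<close>)
    finally show ?thesis by simp
  qed
  have "g t = 0"
  proof (rule ccontr)
    assume "g t \<noteq> 0"
    \<comment> \<open>A nonzero value would grow without bound along the multiples
      \<open>n * t\<close>.\<close>
    then obtain n where "2 * K < real n * \<bar>g t\<bar>"
      using reals_Archimedean3[of "\<bar>g t\<bar>"] by auto
    moreover have "real n * \<bar>g t\<bar> = \<bar>g (real n * t)\<bar>" by (simp add: g_mult[OF t] abs_mult)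
    ultimately show False using g_bound[of "real n * t"] t by simp
  qed
  then show ?thesis by (simp add: g_def)
qed

section \<open>Consequences of a comonotonic cash risk measure\<close>

locale comonotonic_cash_setting = risk_setting +
  assumes cash_comonotonic: "comonotonic M (cash_risk_measure A)"
begin

abbreviation cash :: "('a \<Rightarrow> real) \<Rightarrow> real" where
  "cash \<equiv> cash_risk_measure A"

text \<open>Second instance of the general theory, with cash as the asset; the rewrite states its
  results for \<open>cash_risk_measure\<close>.\<close>

sublocale cash: risk_setting M A 1 "\<lambda>_. 1"
  rewrites "risk_measure A (1, \<lambda>_. 1) = cash_risk_measure A"
  by (unfold_locales) (simp_all add: acceptance eligible_asset_cash cash_risk_measure_eq)

lemma cash_zero: "cash (\<lambda>_. 0) = 0"
  by (rule comonotonic_zero[OF cash_comonotonic])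

lemma cash_const: "cash (\<lambda>_. c) = - c"
  using cash.risk_add_asset[of "\<lambda>_. 0" c] cash_zero by simp

text \<open>Nonnegative multiples of \<open>X\<close> are comonotone, so the cash risk is additive
  along the ray through \<open>X\<close>; it also grows at most linearly there, so
  \<open>additive_bounded_imp_homogeneous\<close> applies.\<close>

lemma cash_cmult:
  assumes X: "X \<in> Linf M" and t: "t \<ge> 0"
  shows "cash (\<lambda>\<omega>. t * X \<omega>) = t * cash X"
proof -
  obtain C where C: "AE \<omega> in M. \<bar>X \<omega>\<bar> \<le> C" using Linf_bound[OF X] by blast
  have "cash (\<lambda>\<omega>. t * X \<omega>) = t * cash (\<lambda>\<omega>. 1 * X \<omega>)"
  proof (rule additive_bounded_imp_homogeneous[where f = "\<lambda>t. cash (\<lambda>\<omega>. t * X \<omega>)", OF _ _ t])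
    fix s t :: real assume "s \<ge> 0" "t \<ge> 0"
    then show "cash (\<lambda>\<omega>. (s + t) * X \<omega>) = cash (\<lambda>\<omega>. s * X \<omega>) + cash (\<lambda>\<omega>. t * X \<omega>)"
      using cash_comonotonic comonotone_cmult[of s t M X] Linf_cmult[OF X]
      unfolding comonotonic_def by (simp add: ring_distribs)
  next
    fix t :: real assume t: "t \<ge> 0"
    have "AE \<omega> in M. \<bar>t * X \<omega>\<bar> \<le> C * t"
      using C by eventually_elim (use t in \<open>simp add: abs_mult mult.commute[of _ t] mult_left_mono\<close>)
    \<comment> \<open>Squeezing \<open>t X\<close> between two constants bounds its cash risk,
      because the cash risk of constants is known.\<close>
    then have "AE \<omega> in M. - (C * t) \<le> t * X \<omega>" "AE \<omega> in M. t * X \<omega> \<le> C * t"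
      by (eventually_elim, simp)+
    then have "cash (\<lambda>\<omega>. t * X \<omega>) \<le> cash (\<lambda>_. - (C * t))"
      and "cash (\<lambda>_. C * t) \<le> cash (\<lambda>\<omega>. t * X \<omega>)"
      by (auto intro!: cash.risk_antimono Linf_cmult X)
    then show "\<bar>cash (\<lambda>\<omega>. t * X \<omega>)\<bar> \<le> C * t" by (simp add: cash_const)
  qed
  then show ?thesis by simp
qed

text \<open>Acceptance means nonpositive cash risk, a condition preserved by nonnegative
  scaling.\<close>

lemma cone:
  assumes "X \<in> A" "t \<ge> 0"
  shows "(\<lambda>\<omega>. t * X \<omega>) \<in> A"
proof -
  have X: "X \<in> Linf M" using assms(1) by (rule A_Linf)
  then have "cash X \<le> 0" using assms(1) cash.mem_iff_risk_le by blast
  then have "cash (\<lambda>\<omega>. t * X \<omega>) \<le> 0"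
    unfolding cash_cmult[OF X assms(2)] using assms(2) by (intro mult_nonneg_nonpos)
  then show ?thesis
    using cash.mem_iff_risk_le[OF Linf_cmult[OF X]] by simp
qed

lemma zero_mem: "(\<lambda>_. 0) \<in> A"
  using cash_zero cash.mem_iff_risk_le[OF Linf_const] by simp

text \<open>The cash needed to make a short position in the payoff of one unit of capital
  acceptable. It acts as the exchange rate between capital in the asset and cash.\<close>

definition p :: real where
  "p = cash (\<lambda>\<omega>. - (S1 \<omega> / S0))"

lemma payoff_Linf: "(\<lambda>\<omega>. - (S1 \<omega> / S0)) \<in> Linf M"
  using Linf_cmult[OF S1_Linf, of "- 1 / S0"] by simp

lemma p_pos: "p > 0"
proof -
  obtain \<delta> where \<delta>: "\<delta> > 0" "AE \<omega> in M. S1 \<omega> / S0 \<ge> \<delta>"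
    by (rule payoff_bound)
  from \<delta>(2) have "AE \<omega> in M. - (S1 \<omega> / S0) \<le> - \<delta>" by eventually_elim simp
  then have "cash (\<lambda>_. - \<delta>) \<le> p"
    unfolding p_def by (intro cash.risk_antimono payoff_Linf) auto
  with \<delta>(1) show ?thesis by (simp add: cash_const)
qed

lemma risk_one: "\<rho> (\<lambda>_. 1) = - 1 / p"
proof -
  \<comment> \<open>Only levels \<open>- t\<close> with \<open>t \<ge> 0\<close> are tested, since
    homogeneity covers nonnegative factors only.\<close>
  have neg: "\<rho> (\<lambda>_. 1) \<le> - t \<longleftrightarrow> t * p \<le> 1" if t: "t \<ge> 0" for t
  proof -
    have L: "(\<lambda>\<omega>. t * - (S1 \<omega> / S0)) \<in> Linf M" by (intro Linf_cmult payoff_Linf)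
    have "\<rho> (\<lambda>_. 1) \<le> - t \<longleftrightarrow> (\<lambda>\<omega>. t * - (S1 \<omega> / S0) + 1) \<in> A"
      by (simp add: risk_le_iff add.commute)
    also have "\<dots> \<longleftrightarrow> cash (\<lambda>\<omega>. t * - (S1 \<omega> / S0)) \<le> 1"
      using cash.risk_le_iff[OF L, of 1] by simp
    also have "\<dots> \<longleftrightarrow> t * p \<le> 1"
      unfolding p_def cash_cmult[OF payoff_Linf t] ..
    finally show ?thesis .
  qed
  \<comment> \<open>The sign makes \<open>- \<rho> (\<lambda>_. 1)\<close> an admissible
    \<open>t\<close>; this choice and \<open>t = 1 / p\<close> give the two inequalities.\<close>
  have "\<rho> (\<lambda>_. 1) \<le> 0" using neg[of 0] by simp
  then have "- \<rho> (\<lambda>_. 1) * p \<le> 1" using neg[of "- \<rho> (\<lambda>_. 1)"] by simp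
  moreover have "\<rho> (\<lambda>_. 1) \<le> - (1 / p)" using neg[of "1 / p"] p_pos by simp
  ultimately show ?thesis using p_pos by (simp add: field_simps)
qed

text \<open>Scale by \<open>1 / \<bar>t\<bar>\<close>, shift once by \<open>V\<close> or
  \<open>- V\<close>, and scale back: the cone property turns a unit shift into a shift of any
  size.\<close>

lemma invariant_imp_multiple_mem:
  assumes inv: "\<forall>X\<in>A. (\<lambda>\<omega>. X \<omega> + V \<omega>) \<in> A \<and> (\<lambda>\<omega>. X \<omega> - V \<omega>) \<in> A"
    and X: "X \<in> A"
  shows "(\<lambda>\<omega>. X \<omega> + t * V \<omega>) \<in> A"
proof -
  consider "t = 0" | "t > 0" | "t < 0" by linarith
  then show ?thesis
  proof cases
    case 1
    then show ?thesis using X by simp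
  next
    case 2
    then have "(\<lambda>\<omega>. t * (1 / t * X \<omega> + V \<omega>)) \<in> A"
      by (intro cone inv[rule_format, THEN conjunct1] X) auto
    with 2 show ?thesis by (simp add: ring_distribs)
  next
    case 3
    then have "(\<lambda>\<omega>. - t * (1 / (- t) * X \<omega> - V \<omega>)) \<in> A"
      by (intro cone inv[rule_format, THEN conjunct2] X) auto
    with 3 show ?thesis by (simp add: ring_distribs)
  qed
qed

lemma invariant_imp_comonotonic:
  assumes inv: "\<forall>X\<in>A. (\<lambda>\<omega>. X \<omega> + (1 + \<rho> (\<lambda>_. 1) / S0 * S1 \<omega>)) \<in> A \<and>
      (\<lambda>\<omega>. X \<omega> - (1 + \<rho> (\<lambda>_. 1) / S0 * S1 \<omega>)) \<in> A"
  shows "comonotonic M \<rho>"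
proof -
  note mult = invariant_imp_multiple_mem[OF inv]
  have risk: "\<rho> X = cash X / p" if X: "X \<in> Linf M" for X
  proof -
    have "\<rho> X \<le> m \<longleftrightarrow> cash X \<le> m * p" for m
    proof -
      \<comment> \<open>Since \<open>\<rho> (\<lambda>_. 1) = - 1 / p\<close>, the hedge is
        \<open>V = 1 - U / p\<close>, so \<open>m\<close> units of capital in the asset and
        \<open>m * p\<close> units of cash differ by a multiple of \<open>V\<close>.\<close>
      have eq: "X \<omega> + m / S0 * S1 \<omega>
          = X \<omega> + m * p + (- (m * p)) * (1 + \<rho> (\<lambda>_. 1) / S0 * S1 \<omega>)" for \<omega>
        using p_pos S0_pos by (simp add: risk_one field_simps)
      then have eq': "X \<omega> + m * p
          = X \<omega> + m / S0 * S1 \<omega> + m * p * (1 + \<rho> (\<lambda>_. 1) / S0 * S1 \<omega>)" for \<omega>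
        by simp
      have "(\<lambda>\<omega>. X \<omega> + m / S0 * S1 \<omega>) \<in> A \<longleftrightarrow> (\<lambda>\<omega>. X \<omega> + m * p) \<in> A"
      proof
        assume "(\<lambda>\<omega>. X \<omega> + m / S0 * S1 \<omega>) \<in> A"
        then show "(\<lambda>\<omega>. X \<omega> + m * p) \<in> A" unfolding eq' by (rule mult)
      next
        assume "(\<lambda>\<omega>. X \<omega> + m * p) \<in> A"
        then show "(\<lambda>\<omega>. X \<omega> + m / S0 * S1 \<omega>) \<in> A" unfolding eq by (rule mult)
      qed
      then show ?thesis
        using risk_le_iff[OF X, of m] cash.risk_le_iff[OF X, of "m * p"] by simp
    qed
    from this[of "\<rho> X"] this[of "cash X / p"] show ?thesis
      using p_pos by (simp add: field_simps)
  qed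
  show ?thesis
    \<comment> \<open>Division by the constant \<open>p\<close> preserves additivity on comonotone
      pairs.\<close>
    using cash_comonotonic unfolding comonotonic_def
    by (simp add: risk Linf_add add_divide_distrib)
qed

text \<open>The position is the multiple \<open>S0 / \<rho> (\<lambda>_. 1)\<close> of
  \<open>V\<close>, where the divisor is nonzero by \<open>risk_one\<close>. Zero is accepted, hence
  so are all multiples of \<open>V\<close>, of either sign.\<close>

lemma comonotonic_imp_hedge_acceptable:
  assumes co: "comonotonic M \<rho>"
  shows "(\<lambda>\<omega>. S1 \<omega> + S0 / \<rho> (\<lambda>_. 1)) \<in> A \<inter> (\<lambda>X \<omega>. - X \<omega>) ` A"
proof -
  note mult = invariant_imp_multiple_mem[OF comonotonic_imp_invariant[OF co] zero_mem]
  have eq: "S1 \<omega> + S0 / \<rho> (\<lambda>_. 1)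
      = 0 + S0 / \<rho> (\<lambda>_. 1) * (1 + \<rho> (\<lambda>_. 1) / S0 * S1 \<omega>)" for \<omega>
    using p_pos S0_pos by (simp add: risk_one field_simps)
  then have eq': "- (S1 \<omega> + S0 / \<rho> (\<lambda>_. 1))
      = 0 + - (S0 / \<rho> (\<lambda>_. 1)) * (1 + \<rho> (\<lambda>_. 1) / S0 * S1 \<omega>)" for \<omega>
    by simp
  have "(\<lambda>\<omega>. S1 \<omega> + S0 / \<rho> (\<lambda>_. 1)) \<in> A" unfolding eq by (rule mult)
  moreover have "(\<lambda>\<omega>. - (S1 \<omega> + S0 / \<rho> (\<lambda>_. 1))) \<in> A" unfolding eq' by (rule mult)
  then have "(\<lambda>\<omega>. - (- (S1 \<omega> + S0 / \<rho> (\<lambda>_. 1)))) \<in> (\<lambda>X \<omega>. - X \<omega>) ` A"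
    by (rule imageI)
  ultimately show ?thesis by (simp only: minus_minus Int_iff)
qed

end

theorem theorem2p18:
  fixes M :: "'a measure" and A :: "('a \<Rightarrow> real) set" and S0 :: real and S1 :: "'a \<Rightarrow> real"
  assumes "prob_space M"
    and "acceptance_set M A"
    and "eligible_asset M (S0, S1)"
    and "comonotonic M (cash_risk_measure A)"
  shows "(comonotonic M (risk_measure A (S0, S1)) \<longleftrightarrow>
            (\<forall>X\<in>A.
               (\<lambda>\<omega>. X \<omega> + (1 + risk_measure A (S0, S1) (\<lambda>_. 1) / S0 * S1 \<omega>)) \<in> A \<and>
               (\<lambda>\<omega>. X \<omega> - (1 + risk_measure A (S0, S1) (\<lambda>_. 1) / S0 * S1 \<omega>)) \<in> A)) \<and>
         (comonotonic M (risk_measure A (S0, S1)) \<longrightarrow>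
            (\<lambda>\<omega>. S1 \<omega> + S0 / risk_measure A (S0, S1) (\<lambda>_. 1)) \<in> A \<inter> (\<lambda>X \<omega>. - X \<omega>) ` A)"
proof -
  interpret comonotonic_cash_setting M A S0 S1
    using assms by unfold_locales
  show ?thesis
    using comonotonic_imp_invariant invariant_imp_comonotonic comonotonic_imp_hedge_acceptable
    by blast
qed

end
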